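(* Let $S=(1,2,2,2,\ldots)$, i.e. $a_1=1$ and $a_i=2$ for all $i\ge 2$. Then $\chi_S(G_3)=6$.
   Context: $G_3$ denotes the integer distance graph $G(\mathbb{Z},\{2,3\})$: its vertex set is $\mathbb{Z}$, and distinct $i,j\in\mathbb{Z}$ are adjacent if and only if $|i-j|\in\{2,3\}$. For a graph $G$ and a non-decreasing sequence $S=(a_1,a_2,\ldots)$ of positive integers, an $S$-packing $k$-coloring of $G$ is a map $f:V(G)\to\{1,\ldots,k\}$ such that any two distinct vertices $u,v$ with $f(u)=f(v)=i$ satisfy $d_G(u,v)>a_i$, where $d_G$ is the shortest-path distance. The $S$-packing chromatic number $\chi_S(G)$ is the smallest $k$ for which $G$ has an $S$-packing $k$-coloring. *)

theory Defs
  imports "Graph_Theory.Graph_Theory" "HOL-Library.Extended_Nat"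
begin

text \<open>
  Undirected simple graphs are represented as symmetric loop-free digraphs without parallel
  arcs; vertex and arc sets may be infinite.
\<close>

definition integer_distance_graph :: "int set \<Rightarrow> int pair_pre_digraph" where
  "integer_distance_graph D =
     \<lparr> pverts = UNIV, parcs = {(i, j). i \<noteq> j \<and> \<bar>i - j\<bar> \<in> D} \<rparr>"

definition G3 :: "int pair_pre_digraph" where
  "G3 = integer_distance_graph {2, 3}"

lemma pair_bidirected_digraph_integer_distance_graph:
  "pair_bidirected_digraph (integer_distance_graph D)"
  by unfold_locales
    (auto simp: integer_distance_graph_def symmetric_def sym_def abs_minus_commute)

text \<open>
  The library's shortest-path distance for unit arc weights. It is extended-real valued, and
  \<open>\<infinity>\<close> for vertices not joined by a walk.
\<close>

definition graph_dist :: "'a pair_pre_digraph \<Rightarrow> 'a \<Rightarrow> 'a \<Rightarrow> ereal" where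
  "graph_dist G u v = wf_digraph.\<mu> (with_proj G) (\<lambda>_. 1) u v"

lemma graph_dist_conv_length:
  assumes "pair_wf_digraph G"
  shows "graph_dist G u v =
    (INF p\<in>{p. pre_digraph.awalk (with_proj G) u p v}. ereal (real (length p)))"
proof -
  interpret wf_digraph "with_proj G"
    using assms by (simp add: pair_wf_digraph_def wf_digraph_def)
  have "awalk_cost (\<lambda>_. 1) p = real (length p)" for p :: "('a \<times> 'a) awalk"
    by (induction p) simp_all
  then show ?thesis
    by (simp add: graph_dist_def \<mu>_def)
qed

text \<open>
  Sequences are indexed from \<open>1\<close>, as the colours are; the entry \<open>a 0\<close> is never used.
\<close>

definition S_packing_coloring ::
    "(nat \<Rightarrow> nat) \<Rightarrow> 'a pair_pre_digraph \<Rightarrow> nat \<Rightarrow> ('a \<Rightarrow> nat) \<Rightarrow> bool" where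
  "S_packing_coloring a G k f \<longleftrightarrow>
     f ` pverts G \<subseteq> {1..k} \<and>
     (\<forall>u\<in>pverts G. \<forall>v\<in>pverts G.
        u \<noteq> v \<longrightarrow> f u = f v \<longrightarrow> ereal (real (a (f u))) < graph_dist G u v)"

text \<open>
  The smallest number of colours, with value \<open>\<infinity>\<close> if no finite number suffices.
\<close>

definition S_packing_chromatic_number :: "(nat \<Rightarrow> nat) \<Rightarrow> 'a pair_pre_digraph \<Rightarrow> enat" where
  "S_packing_chromatic_number a G = (INF k\<in>{k. \<exists>f. S_packing_coloring a G k f}. enat k)"

end

theory Submission
  imports Defs
begin

text \<open>
  Vertices of \<^const>\<open>G3\<close> have distance at most \<open>1\<close> iff their difference lies in \<open>{0, \<plusminus>2, \<plusminus>3}\<close>, and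
  distance at most \<open>2\<close> iff it is at most \<open>6\<close> in absolute value. Any five consecutive integers
  induce a 5-cycle and so contain at most two vertices of colour \<open>1\<close>; any seven consecutive
  integers contain at most one vertex of each other colour. With five colours, at most
  \<open>7 * 2 + 4 * 5 = 34\<close> of \<open>35\<close> consecutive integers would be coloured. For six colours, merge the
  residue classes of \<open>0\<close> and \<open>1\<close> modulo \<open>7\<close> into colour \<open>1\<close>.
\<close>

text \<open>Strictness survives the infimum because walk lengths are integers: if all exceed
  \<open>n\<close>, all are at least \<open>Suc n\<close>. Without any walk both sides hold, the
  distance being \<infinity>.\<close>

lemma less_graph_dist_iff:
  assumes "pair_wf_digraph G"
  shows "ereal (real n) < graph_dist G u v \<longleftrightarrow>
    (\<forall>p. pre_digraph.awalk (with_proj G) u p v \<longrightarrow> n < length p)"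
proof
  assume *: "ereal (real n) < graph_dist G u v"
  show "\<forall>p. pre_digraph.awalk (with_proj G) u p v \<longrightarrow> n < length p"
  proof (intro allI impI)
    fix p assume "pre_digraph.awalk (with_proj G) u p v"
    then have "graph_dist G u v \<le> ereal (real (length p))"
      unfolding graph_dist_conv_length[OF assms] by (intro INF_lower) simp
    with * have "ereal (real n) < ereal (real (length p))"
      by (rule less_le_trans)
    then show "n < length p" by simp
  qed
next
  assume *: "\<forall>p. pre_digraph.awalk (with_proj G) u p v \<longrightarrow> n < length p"
  have "ereal (real n) < ereal (real (Suc n))" by simp
  also have "\<dots> \<le> graph_dist G u v"
    unfolding graph_dist_conv_length[OF assms]
    by (intro INF_greatest) (use * in \<open>auto simp: Suc_le_eq simp del: of_nat_Suc\<close>)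
  finally show "ereal (real n) < graph_dist G u v" .
qed

lemma pair_wf_digraph_G3: "pair_wf_digraph G3"
  using pair_bidirected_digraph_integer_distance_graph[of "{2, 3}"]
  by (simp add: G3_def pair_bidirected_digraph_def pair_digraph_def pair_fin_digraph_def
      pair_wf_digraph_def integer_distance_graph_def)

lemma verts_G3: "pverts G3 = UNIV"
  by (simp add: G3_def integer_distance_graph_def)

lemma arcs_G3: "(u, v) \<in> parcs G3 \<longleftrightarrow> \<bar>u - v\<bar> \<in> {2, 3}"
  by (auto simp: G3_def integer_distance_graph_def)

lemma awalk_G3_Nil_iff: "pre_digraph.awalk (with_proj G3) u [] v \<longleftrightarrow> u = v"
proof -
  interpret pair_wf_digraph G3 by (rule pair_wf_digraph_G3)
  show ?thesis by (simp add: awalk_Nil_iff verts_G3)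
qed

lemma awalk_G3_Cons_iff:
  "pre_digraph.awalk (with_proj G3) u (e # p) v \<longleftrightarrow>
    fst e = u \<and> \<bar>u - snd e\<bar> \<in> {2, 3} \<and> pre_digraph.awalk (with_proj G3) (snd e) p v"
proof -
  interpret pair_wf_digraph G3 by (rule pair_wf_digraph_G3)
  show ?thesis
    by (cases e) (auto simp: awalk_Cons_iff arcs_G3)
qed

lemma awalk_G3_abs_diff_le:
  "pre_digraph.awalk (with_proj G3) u p v \<Longrightarrow> \<bar>u - v\<bar> \<le> 3 * int (length p)"
proof (induction p arbitrary: u)
  case Nil
  then show ?case by (simp add: awalk_G3_Nil_iff)
next
  case (Cons e p)
  then have "\<bar>u - snd e\<bar> \<le> 3" "\<bar>snd e - v\<bar> \<le> 3 * int (length p)"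
    by (auto simp: awalk_G3_Cons_iff)
  then show ?case by simp
qed

lemma one_less_graph_dist_G3_iff:
  assumes "u \<noteq> v"
  shows "ereal (real 1) < graph_dist G3 u v \<longleftrightarrow> \<bar>u - v\<bar> \<notin> {2, 3}"
proof
  assume "ereal (real 1) < graph_dist G3 u v"
  then have "\<not> pre_digraph.awalk (with_proj G3) u [(u, v)] v"
    unfolding less_graph_dist_iff[OF pair_wf_digraph_G3] by fastforce
  then show "\<bar>u - v\<bar> \<notin> {2, 3}"
    by (simp add: awalk_G3_Cons_iff awalk_G3_Nil_iff)
next
  assume *: "\<bar>u - v\<bar> \<notin> {2, 3}"
  have "1 < length p" if "pre_digraph.awalk (with_proj G3) u p v" for p
  proof (rule ccontr)
    assume "\<not> 1 < length p"
    \<comment> \<open>The empty walk would force \<open>u = v\<close>, and a single arc would make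
      \<open>u\<close> and \<open>v\<close> adjacent.\<close>
    then have "p = [] \<or> (\<exists>e. p = [e])" by (cases p) auto
    with that assms * show False by (auto simp: awalk_G3_Cons_iff awalk_G3_Nil_iff)
  qed
  then show "ereal (real 1) < graph_dist G3 u v"
    unfolding less_graph_dist_iff[OF pair_wf_digraph_G3] by blast
qed

lemma two_less_graph_dist_G3_iff:
  assumes "u \<noteq> v"
  shows "ereal (real 2) < graph_dist G3 u v \<longleftrightarrow> 7 \<le> \<bar>u - v\<bar>"
proof
  assume "ereal (real 2) < graph_dist G3 u v"
  then have long: "2 < length p" if "pre_digraph.awalk (with_proj G3) u p v" for p
    using that unfolding less_graph_dist_iff[OF pair_wf_digraph_G3] by blast
  have no_edge: "\<bar>u - v\<bar> \<notin> {2, 3}"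
    using long[of "[(u, v)]"] by (auto simp: awalk_G3_Cons_iff awalk_G3_Nil_iff)
  have no_path: "\<bar>u - w\<bar> \<notin> {2, 3} \<or> \<bar>w - v\<bar> \<notin> {2, 3}" for w
    using long[of "[(u, w), (w, v)]"] by (auto simp: awalk_G3_Cons_iff awalk_G3_Nil_iff)
  \<comment> \<open>The four neighbours of \<open>u\<close> are the possible midpoints of a walk of
    length 2. They exclude the differences 1 = 3 - 2, 4 = 2 + 2, 5 = 2 + 3 and 6 = 3 + 3, up to
    sign; adjacency excludes 2 and 3.\<close>
  show "7 \<le> \<bar>u - v\<bar>"
    using assms no_edge no_path[of "u + 2"] no_path[of "u + 3"] no_path[of "u - 2"]
      no_path[of "u - 3"]
    by simp arith
next
  assume *: "7 \<le> \<bar>u - v\<bar>"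
  have "2 < length p" if "pre_digraph.awalk (with_proj G3) u p v" for p
    using awalk_G3_abs_diff_le[OF that] * by linarith
  then show "ereal (real 2) < graph_dist G3 u v"
    unfolding less_graph_dist_iff[OF pair_wf_digraph_G3] by blast
qed

text \<open>Turns the colouring condition into arithmetic on \<int>, so that the two bounds below
  need no walks.\<close>

lemma S_packing_coloring_G3_iff:
  assumes "a 1 = 1" and "\<forall>i\<ge>2. a i = 2"
  shows "S_packing_coloring a G3 k f \<longleftrightarrow>
    range f \<subseteq> {1..k} \<and>
    (\<forall>u v. u \<noteq> v \<longrightarrow> f u = f v \<longrightarrow> (if f u = 1 then \<bar>u - v\<bar> \<notin> {2, 3} else 7 \<le> \<bar>u - v\<bar>))"
proof -
  have "ereal (real (a (f u))) < graph_dist G3 u v \<longleftrightarrow>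
      (if f u = 1 then \<bar>u - v\<bar> \<notin> {2, 3} else 7 \<le> \<bar>u - v\<bar>)"
    if "range f \<subseteq> {1..k}" "u \<noteq> v" for u v
  proof (cases "f u = 1")
    case True
    then show ?thesis using one_less_graph_dist_G3_iff[OF \<open>u \<noteq> v\<close>] assms(1) by simp
  next
    case False
    \<comment> \<open>This excludes colour 0, for which nothing is known about
      \<open>a\<close>.\<close>
    have "f u \<in> {1..k}" using that(1) by blast
    with False have "a (f u) = 2" using assms(2) by simp
    then show ?thesis using False two_less_graph_dist_G3_iff[OF \<open>u \<noteq> v\<close>] by simp
  qed
  then show ?thesis unfolding S_packing_coloring_def verts_G3 by (metis UNIV_I)
qed

text \<open>The long interval is cut into \<open>n\<close> consecutive blocks of length
  \<open>m\<close>, each contributing at most \<open>r\<close>. Colour 1 uses blocks of length 5,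
  every other colour blocks of length 7.\<close>

lemma card_window_mult_le:
  fixes m :: int and P :: "int \<Rightarrow> bool"
  assumes "m \<ge> 0" and "\<And>x. card {i \<in> {x..<x + m}. P i} \<le> r"
  shows "card {i \<in> {x..<x + m * int n}. P i} \<le> r * n"
proof (induction n)
  case (Suc n)
  define y where "y = x + m * int n"
  have "x \<le> y" and eq: "x + m * int (Suc n) = y + m"
    using \<open>m \<ge> 0\<close> by (simp_all add: y_def distrib_left)
  then have "{i \<in> {x..<y + m}. P i} = {i \<in> {x..<y}. P i} \<union> {i \<in> {y..<y + m}. P i}"
    using \<open>m \<ge> 0\<close> by auto
  then have "card {i \<in> {x..<x + m * int (Suc n)}. P i} \<le>
      card {i \<in> {x..<y}. P i} + card {i \<in> {y..<y + m}. P i}"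
    by (simp only: eq card_Un_le)
  also have "\<dots> \<le> r * n + r" by (intro add_mono Suc[folded y_def] assms(2))
  finally show ?case by simp
qed simp

lemma card_window_5_le_2:
  fixes P :: "int \<Rightarrow> bool"
  assumes "\<And>u v. P u \<Longrightarrow> P v \<Longrightarrow> \<bar>u - v\<bar> \<notin> {2, 3}"
  shows "card {i \<in> {x..<x + 5}. P i} \<le> 2"
proof -
  have window: "{i \<in> {x..<x + 5}. P i} \<subseteq> {x, x + 1, x + 2, x + 3, x + 4}" by auto
  have "\<exists>a b. {i \<in> {x..<x + 5}. P i} \<subseteq> {a, b}"
  proof -
    have "\<not> (P x \<and> P (x + 2))" "\<not> (P x \<and> P (x + 3))" "\<not> (P (x + 1) \<and> P (x + 3))"
      "\<not> (P (x + 1) \<and> P (x + 4))" "\<not> (P (x + 2) \<and> P (x + 4))"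
      using assms[of x "x + 2"] assms[of x "x + 3"] assms[of "x + 1" "x + 3"]
        assms[of "x + 1" "x + 4"] assms[of "x + 2" "x + 4"] by auto
    \<comment> \<open>The offsets form the 5-cycle 0, 2, 4, 1, 3. Each case is the complement of one
      of its five maximal independent sets, all of size 2.\<close>
    then consider "\<not> P (x + 2)" "\<not> P (x + 3)" "\<not> P (x + 1)"
      | "\<not> P (x + 2)" "\<not> P (x + 3)" "\<not> P (x + 4)"
      | "\<not> P x" "\<not> P (x + 1)" "\<not> P (x + 2)"
      | "\<not> P x" "\<not> P (x + 1)" "\<not> P (x + 4)"
      | "\<not> P x" "\<not> P (x + 3)" "\<not> P (x + 4)"
      by blast
    then show ?thesis
    proof cases
      case 1
      then have "{i \<in> {x..<x + 5}. P i} \<subseteq> {x, x + 4}" using window by blast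
      then show ?thesis by blast
    next
      case 2
      then have "{i \<in> {x..<x + 5}. P i} \<subseteq> {x, x + 1}" using window by blast
      then show ?thesis by blast
    next
      case 3
      then have "{i \<in> {x..<x + 5}. P i} \<subseteq> {x + 3, x + 4}" using window by blast
      then show ?thesis by blast
    next
      case 4
      then have "{i \<in> {x..<x + 5}. P i} \<subseteq> {x + 2, x + 3}" using window by blast
      then show ?thesis by blast
    next
      case 5
      then have "{i \<in> {x..<x + 5}. P i} \<subseteq> {x + 1, x + 2}" using window by blast
      then show ?thesis by blast
    qed
  qed
  then obtain a b where "{i \<in> {x..<x + 5}. P i} \<subseteq> {a, b}" by blast
  then have "card {i \<in> {x..<x + 5}. P i} \<le> card {a, b}" by (intro card_mono) auto
  also have "\<dots> \<le> 2" by (simp add: card_insert_if)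
  finally show ?thesis .
qed

lemma card_window_le_1:
  fixes P :: "int \<Rightarrow> bool" and m :: int
  assumes "\<And>u v. P u \<Longrightarrow> P v \<Longrightarrow> u \<noteq> v \<Longrightarrow> m \<le> \<bar>u - v\<bar>"
  shows "card {i \<in> {x..<x + m}. P i} \<le> 1"
proof -
  have "u = v" if "u \<in> {i \<in> {x..<x + m}. P i}" "v \<in> {i \<in> {x..<x + m}. P i}" for u v
    using assms[of u v] that by fastforce
  then have "card {i \<in> {x..<x + m}. P i} \<le> Suc 0"
    by (subst card_le_Suc0_iff_eq) (auto intro: finite_subset[of _ "{x..<x + m}"])
  then show ?thesis by simp
qed

lemma S_packing_coloring_G3_ge_6:
  assumes "a 1 = 1" and "\<forall>i\<ge>2. a i = 2" and "S_packing_coloring a G3 k f"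
  shows "6 \<le> k"
proof (rule ccontr)
  assume "\<not> 6 \<le> k"
  note coloring = assms(3)[unfolded S_packing_coloring_G3_iff[OF assms(1,2)]]
  from coloring have range: "range f \<subseteq> {1..k}"
    and sep: "\<And>u v. u \<noteq> v \<Longrightarrow> f u = f v \<Longrightarrow>
      if f u = 1 then \<bar>u - v\<bar> \<notin> {2, 3} else 7 \<le> \<bar>u - v\<bar>"
    by blast+
  \<comment> \<open>35 is the least common multiple of 5 and 7, so seven windows of length 5 and
    five of length 7 both tile this interval exactly.\<close>
  let ?A = "\<lambda>c. {i \<in> {0..<35::int}. f i = c}"
  have "card {i \<in> {x..<x + 5}. f i = 1} \<le> 2" for x
  proof (rule card_window_5_le_2)
    show "\<bar>u - v\<bar> \<notin> {2, 3}" if "f u = 1" "f v = 1" for u v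
      using sep[of u v] that by (cases "u = v") auto
  qed
  from card_window_mult_le[OF _ this, of 0 7] have colour_1: "card (?A 1) \<le> 14" by simp
  have other: "card (?A c) \<le> 5" if "c \<noteq> 1" for c
  proof -
    have "card {i \<in> {x..<x + 7}. f i = c} \<le> 1" for x
    proof (rule card_window_le_1)
      show "7 \<le> \<bar>u - v\<bar>" if "f u = c" "f v = c" "u \<noteq> v" for u v
        using sep[of u v] that \<open>c \<noteq> 1\<close> by auto
    qed
    from card_window_mult_le[OF _ this, of 0 5] show ?thesis by simp
  qed
  \<comment> \<open>This covers every \<open>k\<close> below 6 at once; colours that do not occur
    have empty classes.\<close>
  have "f i \<in> {1..5}" for i
    using range \<open>\<not> 6 \<le> k\<close> by (fastforce simp: subset_iff)
  then have "{0..<35} = (\<Union>c\<in>{1..5}. ?A c)" by blast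
  then have "card {0..<35::int} = card (\<Union>c\<in>{1..5}. ?A c)" by (rule arg_cong)
  also have "\<dots> \<le> (\<Sum>c\<in>{1..5}. card (?A c))" by (rule card_UN_le) simp
  also have "{1..5::nat} = insert 1 {2..5}" by auto
  also have "(\<Sum>c\<in>insert 1 {2..5}. card (?A c)) = card (?A 1) + (\<Sum>c\<in>{2..5}. card (?A c))"
    by simp
  also have "\<dots> \<le> 14 + (\<Sum>c\<in>{2..5::nat}. 5)"
    by (intro add_mono colour_1 sum_mono other) auto
  finally show False by simp
qed

lemma S_packing_coloring_G3_6:
  assumes "a 1 = 1" and "\<forall>i\<ge>2. a i = 2"
  shows "S_packing_coloring a G3 6 (\<lambda>i. nat (max 1 (i mod 7)))"
proof -
  have "max 1 (i mod 7) \<in> {1..6}" for i :: int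
    using pos_mod_bound[of 7 i] by auto
  then have "range (\<lambda>i::int. nat (max 1 (i mod 7))) \<subseteq> {1..6}" by fastforce
  moreover have "if nat (max 1 (u mod 7)) = 1 then \<bar>u - v\<bar> \<notin> {2, 3} else 7 \<le> \<bar>u - v\<bar>"
    if "u \<noteq> v" "nat (max 1 (u mod 7)) = nat (max 1 (v mod 7))" for u v :: int
  proof -
    have same: "max 1 (u mod 7) = max 1 (v mod 7)" using that(2) by (simp add: eq_nat_nat_iff)
    show ?thesis
    proof (cases "max 1 (u mod 7) = 1")
      case True
      then have "u mod 7 \<le> 1" "v mod 7 \<le> 1" using same by auto
      \<comment> \<open>With both residues in {0, 1}, the difference is congruent to -1, 0 or 1
        modulo 7, while \<plusminus>2 and \<plusminus>3 are not.\<close>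
      then have "\<bar>u - v\<bar> \<noteq> 2 \<and> \<bar>u - v\<bar> \<noteq> 3" by presburger
      with True show ?thesis by simp
    next
      case False
      \<comment> \<open>Above colour 1 the colour is the residue itself, so distinct vertices
        sharing it differ by a nonzero multiple of 7.\<close>
      then have "u mod 7 = v mod 7" using same by (auto simp: max_def split: if_splits)
      then have "7 \<le> \<bar>u - v\<bar>" using \<open>u \<noteq> v\<close> by presburger
      moreover have "nat (max 1 (u mod 7)) \<noteq> 1" using False by (simp add: nat_eq_iff)
      ultimately show ?thesis by (simp only: if_False)
    qed
  qed
  ultimately show ?thesis
    unfolding S_packing_coloring_G3_iff[OF assms] by blast
qed

theorem theorem3:
  fixes a :: "nat \<Rightarrow> nat"
  assumes "a 1 = 1"
    and "\<And>i. i \<ge> 2 \<Longrightarrow> a i = 2"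
  shows "S_packing_chromatic_number a G3 = 6"
proof (rule antisym)
  have a_ge_2: "\<forall>i\<ge>2. a i = 2" using assms(2) by blast
  have "S_packing_chromatic_number a G3 \<le> enat 6"
    unfolding S_packing_chromatic_number_def
    using S_packing_coloring_G3_6[OF assms(1) a_ge_2] by (intro INF_lower) blast
  then show "S_packing_chromatic_number a G3 \<le> 6" by (simp add: numeral_eq_enat)
  \<comment> \<open>The infimum is at least 6 because each admissible \<open>k\<close> is.\<close>
  have "enat 6 \<le> S_packing_chromatic_number a G3"
    unfolding S_packing_chromatic_number_def
    using S_packing_coloring_G3_ge_6[OF assms(1) a_ge_2] by (intro INF_greatest) auto
  then show "6 \<le> S_packing_chromatic_number a G3" by (simp add: numeral_eq_enat)
qed

end
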